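(* Let $T$ be a compact torus acting continuously on a topological space $X$, such that the action has only finitely many infinitesimal isotropies (i.e. the set $\{\mathfrak{t}_p\mid p\in X\}$ is finite). Then the cokernel of the restriction map $r:\mathcal{A}_T(X)\to\mathcal{A}_T(X^T)$ is $S(\mathfrak{t}^* )$-torsion.
   Context: $\mathfrak{t}$ is the Lie algebra of $T$; for $p\in X$, $\mathfrak{t}_p\subset\mathfrak{t}$ is the Lie algebra of the isotropy group $T_p$ (the infinitesimal isotropy at $p$). For a subspace $\mathfrak{h}\subset\mathfrak{t}$, $S(\mathfrak{h}^* )$ is the algebra of real polynomial functions on $\mathfrak{h}$. A (polynomial) assignment on a $T$-space $X$ is a map $A$ assigning to each $p\in X$ a polynomial $A(p)\in S(\mathfrak{t}_p^* )$ such that for every (connected) subtorus $H\subset T$ with Lie algebra $\mathfrak{h}$, the map $p\mapsto A(p)|_{\mathfrak{h}}$ is locally constant on the fixed point set $X^H$. $\mathcal{A}_T(X)$ denotes the set of all assignments, an $S(\mathfrak{t}^* )$-algebra with pointwise operations, $(fA)(p)=f|_{\mathfrak{t}_p}A(p)$; in particular $\mathcal{A}_T(\emptyset)=\{0\}$. For a $T$-invariant subspace $Y\subset X$, the restriction map $\mathcal{A}_T(X)\to\mathcal{A}_T(Y)$ sends $A$ to $A|_Y$. $X^T$ is the set of $T$-fixed points. *)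

theory Defs
  imports "HOL-Analysis.Analysis" "HOL-Algebra.Module" "HOL-Algebra.AbelCoset"
begin

section \<open>Tori and their Lie algebras\<close>

text \<open>The ambient abelian topological group is a type and is written additively. A torus in it is
  a subgroup that, with the subspace topology, is isomorphic as a topological group to
  \<open>(S\<^sup>1)\<^sup>n\<close> for some \<open>n \<ge> 0\<close>. The group \<open>T\<close> itself is a compact torus if \<open>is_torus UNIV\<close>, and
  the subtori of \<open>T\<close> are the sets \<open>H\<close> with \<open>is_torus H\<close>.\<close>

definition is_torus :: "'g::topological_ab_group_add set \<Rightarrow> bool" where
  "is_torus H \<longleftrightarrow>
     0 \<in> H \<and> (\<forall>g\<in>H. \<forall>h\<in>H. g - h \<in> H) \<and>
     (\<exists>(n::nat) \<phi>.
        homeomorphic_map (top_of_set H)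
          (product_topology (\<lambda>_. top_of_set (sphere (0::complex) 1)) {..<n}) \<phi> \<and>
        (\<forall>g\<in>H. \<forall>h\<in>H. \<forall>i<n. \<phi> (g + h) i = \<phi> g i * \<phi> h i))"

text \<open>The Lie algebra is realised as the set of one-parameter subgroups (\<open>\<xi>\<close> corresponds to
  \<open>s \<mapsto> exp (s \<xi>)\<close>). For an abelian group its vector space operations are
  \<open>(\<xi> + \<eta>)(s) = \<xi> s + \<eta> s\<close> and \<open>(c \<xi>)(s) = \<xi> (c s)\<close>. The definition also makes sense
  for subgroups \<open>H\<close> that are not closed.\<close>

definition lie_algebra :: "'g::topological_ab_group_add set \<Rightarrow> (real \<Rightarrow> 'g) set" where
  "lie_algebra H = {\<xi>. continuous_on UNIV \<xi> \<and> Modules.additive \<xi> \<and> range \<xi> \<subseteq> H}"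

definition linear_form :: "(real \<Rightarrow> 'g::topological_ab_group_add) set \<Rightarrow> ((real \<Rightarrow> 'g) \<Rightarrow> real) \<Rightarrow> bool" where
  "linear_form \<hh> l \<longleftrightarrow>
     (\<forall>\<xi>\<in>\<hh>. \<forall>\<eta>\<in>\<hh>. l (\<lambda>s. \<xi> s + \<eta> s) = l \<xi> + l \<eta>) \<and>
     (\<forall>\<xi>\<in>\<hh>. \<forall>c. l (\<lambda>s. \<xi> (c * s)) = c * l \<xi>)"

text \<open>Functions on a set are represented by their extensional versions (\<open>undefined\<close> off the set),
  so that equality of representatives is equality of functions.\<close>

inductive_set polynomials :: "(real \<Rightarrow> 'g::topological_ab_group_add) set \<Rightarrow> ((real \<Rightarrow> 'g) \<Rightarrow> real) set"
  for \<hh> where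
  const: "(\<lambda>\<xi>\<in>\<hh>. c) \<in> polynomials \<hh>"
| linear: "linear_form \<hh> l \<Longrightarrow> (\<lambda>\<xi>\<in>\<hh>. l \<xi>) \<in> polynomials \<hh>"
| add: "f \<in> polynomials \<hh> \<Longrightarrow> g \<in> polynomials \<hh> \<Longrightarrow> (\<lambda>\<xi>\<in>\<hh>. f \<xi> + g \<xi>) \<in> polynomials \<hh>"
| mult: "f \<in> polynomials \<hh> \<Longrightarrow> g \<in> polynomials \<hh> \<Longrightarrow> (\<lambda>\<xi>\<in>\<hh>. f \<xi> * g \<xi>) \<in> polynomials \<hh>"

definition polynomial_ring ::
    "(real \<Rightarrow> 'g::topological_ab_group_add) set \<Rightarrow> ((real \<Rightarrow> 'g) \<Rightarrow> real) ring" where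
  "polynomial_ring \<hh> =
     \<lparr>carrier = polynomials \<hh>,
      mult = (\<lambda>f g. \<lambda>\<xi>\<in>\<hh>. f \<xi> * g \<xi>),
      one = (\<lambda>\<xi>\<in>\<hh>. 1),
      zero = (\<lambda>\<xi>\<in>\<hh>. 0),
      add = (\<lambda>f g. \<lambda>\<xi>\<in>\<hh>. f \<xi> + g \<xi>)\<rparr>"


section \<open>Torus actions\<close>

definition continuous_action ::
    "('g::topological_ab_group_add \<Rightarrow> 'x \<Rightarrow> 'x) \<Rightarrow> 'x topology \<Rightarrow> bool" where
  "continuous_action act X \<longleftrightarrow>
     continuous_map (prod_topology euclidean X) X (\<lambda>(g, p). act g p) \<and>
     (\<forall>p\<in>topspace X. act 0 p = p) \<and>
     (\<forall>p\<in>topspace X. \<forall>g h. act (g + h) p = act g (act h p))"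

definition isotropy :: "('g \<Rightarrow> 'x \<Rightarrow> 'x) \<Rightarrow> 'x \<Rightarrow> 'g set" where
  "isotropy act p = {g. act g p = p}"

definition inf_isotropy ::
    "('g::topological_ab_group_add \<Rightarrow> 'x \<Rightarrow> 'x) \<Rightarrow> 'x \<Rightarrow> (real \<Rightarrow> 'g) set" where
  "inf_isotropy act p = lie_algebra (isotropy act p)"

definition fixed_points :: "('g \<Rightarrow> 'x \<Rightarrow> 'x) \<Rightarrow> 'x topology \<Rightarrow> 'g set \<Rightarrow> 'x set" where
  "fixed_points act X H = {p \<in> topspace X. \<forall>g\<in>H. act g p = p}"


section \<open>Assignments\<close>

definition locally_constant_on :: "'x topology \<Rightarrow> 'x set \<Rightarrow> ('x \<Rightarrow> 'b) \<Rightarrow> bool" where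
  "locally_constant_on X S f \<longleftrightarrow>
     (\<forall>p\<in>S. \<exists>U. openin (subtopology X S) U \<and> p \<in> U \<and> (\<forall>q\<in>U. f q = f p))"

definition assignments ::
    "('g::topological_ab_group_add \<Rightarrow> 'x \<Rightarrow> 'x) \<Rightarrow> 'x topology \<Rightarrow>
     ('x \<Rightarrow> (real \<Rightarrow> 'g) \<Rightarrow> real) set" where
  "assignments act X =
     {A \<in> (\<Pi>\<^sub>E p\<in>topspace X. polynomials (inf_isotropy act p)).
        \<forall>H. is_torus H \<longrightarrow>
          locally_constant_on X (fixed_points act X H) (\<lambda>p. restrict (A p) (lie_algebra H))}"

definition assignment_algebra ::
    "('g::topological_ab_group_add \<Rightarrow> 'x \<Rightarrow> 'x) \<Rightarrow> 'x topology \<Rightarrow>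
     ((real \<Rightarrow> 'g) \<Rightarrow> real, 'x \<Rightarrow> (real \<Rightarrow> 'g) \<Rightarrow> real) module" where
  "assignment_algebra act X =
     \<lparr>carrier = assignments act X,
      mult = (\<lambda>A B. \<lambda>p\<in>topspace X. \<lambda>\<xi>\<in>inf_isotropy act p. A p \<xi> * B p \<xi>),
      one = (\<lambda>p\<in>topspace X. \<lambda>\<xi>\<in>inf_isotropy act p. 1),
      zero = (\<lambda>p\<in>topspace X. \<lambda>\<xi>\<in>inf_isotropy act p. 0),
      add = (\<lambda>A B. \<lambda>p\<in>topspace X. \<lambda>\<xi>\<in>inf_isotropy act p. A p \<xi> + B p \<xi>),
      smult = (\<lambda>f A. \<lambda>p\<in>topspace X. \<lambda>\<xi>\<in>inf_isotropy act p. f \<xi> * A p \<xi>)\<rparr>"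

definition restriction_map :: "'x set \<Rightarrow> ('x \<Rightarrow> 'b) \<Rightarrow> ('x \<Rightarrow> 'b)" where
  "restriction_map Y A = restrict A Y"


section \<open>Cokernels and torsion modules\<close>

text \<open>The \<open>module\<close> record contains the multiplicative fields of a ring, which have no meaning for a
  quotient by a submodule and are left unspecified.\<close>

definition quotient_module :: "('r, 'm) module \<Rightarrow> 'm set \<Rightarrow> ('r, 'm set) module" where
  "quotient_module M N =
     \<lparr>carrier = a_rcosets\<^bsub>M\<^esub> N,
      mult = undefined,
      one = undefined,
      zero = N,
      add = set_add M,
      smult = (\<lambda>r C. \<Union>x\<in>C. N +>\<^bsub>M\<^esub> (r \<odot>\<^bsub>M\<^esub> x))\<rparr>"

definition cokernel ::
    "('r, 'l) module \<Rightarrow> ('r, 'm) module \<Rightarrow> ('l \<Rightarrow> 'm) \<Rightarrow> ('r, 'm set) module" where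
  "cokernel L M \<phi> = quotient_module M (\<phi> ` carrier L)"

text \<open>Torsion over an integral domain \<open>R\<close>.\<close>

definition torsion_module :: "('r, 'z) ring_scheme \<Rightarrow> ('r, 'm) module \<Rightarrow> bool" where
  "torsion_module R M \<longleftrightarrow>
     (\<forall>x\<in>carrier M. \<exists>r\<in>carrier R. r \<noteq> \<zero>\<^bsub>R\<^esub> \<and> r \<odot>\<^bsub>M\<^esub> x = \<zero>\<^bsub>M\<^esub>)"

end

theory Submission
  imports Defs
begin

text \<open>
  One polynomial \<open>f\<close> on \<open>\<tt>\<close> annihilates the whole cokernel. Among the finitely many infinitesimal
  isotropies, those different from \<open>\<tt>\<close> are proper subspaces, and each lies in the kernel of some
  nonzero linear form; \<open>f\<close> is the product of these forms. It is not the zero function, because a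
  real vector space is not a finite union of hyperplanes
  (\<open>polynomial_vanishing_on_proper_subspaces\<close>).

  If \<open>A\<close> is an assignment on \<open>X\<^sup>T\<close>, then \<open>f A\<close> extends to \<open>X\<close> by zero
  (\<open>assignments_smult_extension_by_zero\<close>). To see that the extension is locally constant on \<open>X\<^sup>H\<close>,
  for a subtorus \<open>H\<close> with Lie algebra \<open>\<hh>\<close>, distinguish two cases. If some point \<open>q\<close> of \<open>X\<^sup>H\<close> is
  not fixed by \<open>T\<close>, then \<open>\<hh> \<subseteq> \<tt>\<^sub>q\<close>, and \<open>\<tt>\<^sub>q\<close> is proper, so \<open>f\<close> vanishes on \<open>\<hh>\<close> and the
  restriction to \<open>\<hh>\<close> is identically zero. Otherwise \<open>X\<^sup>H = X\<^sup>T\<close>, where local constancy is inherited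
  from \<open>A\<close>. The case distinction rests on the equivalence of \<open>\<tt>\<^sub>p = \<tt>\<close> and \<open>p \<in> X\<^sup>T\<close>
  (\<open>inf_isotropy_eq_lie_algebra_iff\<close>), that is, on the surjectivity of the exponential map of a
  torus.
\<close>

section \<open>The vector space of one-parameter subgroups\<close>

lemma lie_algebra_mono: "H \<subseteq> K \<Longrightarrow> lie_algebra H \<subseteq> lie_algebra K"
  unfolding lie_algebra_def by blast

lemma lie_algebra_scale:
  assumes "\<xi> \<in> lie_algebra H"
  shows "(\<lambda>s. \<xi> (c * s)) \<in> lie_algebra H"
proof -
  have "continuous_on UNIV (\<lambda>s. \<xi> (c * s))"
    using assms unfolding lie_algebra_def
    by (intro continuous_on_compose2[of UNIV \<xi> UNIV "\<lambda>s. c * s"] continuous_intros) auto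
  then show ?thesis
    using assms unfolding lie_algebra_def
    by (auto simp: Modules.additive_def distrib_left)
qed

lemma lie_algebra_add:
  assumes "\<And>g h. g \<in> H \<Longrightarrow> h \<in> H \<Longrightarrow> g + h \<in> H" "\<xi> \<in> lie_algebra H" "\<eta> \<in> lie_algebra H"
  shows "(\<lambda>s. \<xi> s + \<eta> s) \<in> lie_algebra H"
proof -
  have "\<xi> s + \<eta> s \<in> H" for s
    using assms unfolding lie_algebra_def by blast
  then show ?thesis
    using assms(2,3) unfolding lie_algebra_def
    by (auto simp: Modules.additive_def algebra_simps intro!: continuous_intros)
qed

lemma lie_algebra_zero: "0 \<in> H \<Longrightarrow> (\<lambda>s. 0) \<in> lie_algebra H"
  unfolding lie_algebra_def by (auto simp: Modules.additive_def)

text \<open>The Lie algebra of the ambient group is turned into a type, so that the linear algebra of real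
  vector spaces applies to it. It is a vector space only as a set of one-parameter subgroups:
  \<open>(a + b) \<xi> = a \<xi> + b \<xi>\<close> expresses the additivity of \<open>\<xi>\<close>.\<close>

typedef (overloaded) 'g one_param = "lie_algebra (UNIV :: 'g::topological_ab_group_add set)"
  using lie_algebra_zero by blast

setup_lifting type_definition_one_param

instantiation one_param :: (topological_ab_group_add) real_vector
begin

lift_definition zero_one_param :: "'a one_param" is "\<lambda>s. 0"
  by (simp add: lie_algebra_zero)

lift_definition plus_one_param :: "'a one_param \<Rightarrow> 'a one_param \<Rightarrow> 'a one_param"
  is "\<lambda>\<xi> \<eta> s. \<xi> s + \<eta> s"
  by (simp add: lie_algebra_add)

lift_definition uminus_one_param :: "'a one_param \<Rightarrow> 'a one_param" is "\<lambda>\<xi> s. - \<xi> s"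
  by (auto simp: lie_algebra_def Modules.additive_def intro!: continuous_intros)

lift_definition minus_one_param :: "'a one_param \<Rightarrow> 'a one_param \<Rightarrow> 'a one_param"
  is "\<lambda>\<xi> \<eta> s. \<xi> s - \<eta> s"
  by (auto simp: lie_algebra_def Modules.additive_def algebra_simps intro!: continuous_intros)

lift_definition scaleR_one_param :: "real \<Rightarrow> 'a one_param \<Rightarrow> 'a one_param"
  is "\<lambda>c \<xi> s. \<xi> (c * s)"
  by (rule lie_algebra_scale)

instance
proof
  fix a b c :: "'a one_param" and r s :: real
  show "a + b + c = a + (b + c)" by transfer (simp add: add.assoc)
  show "a + b = b + a" by transfer (simp add: add.commute)
  show "0 + a = a" by transfer simp
  show "- a + a = 0" by transfer simp
  show "a - b = a + - b" by transfer simp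
  show "r *\<^sub>R (a + b) = r *\<^sub>R a + r *\<^sub>R b" by transfer simp
  show "(r + s) *\<^sub>R a = r *\<^sub>R a + s *\<^sub>R a"
    by transfer (auto simp: lie_algebra_def Modules.additive_def distrib_right)
  show "r *\<^sub>R s *\<^sub>R a = (r * s) *\<^sub>R a" by transfer (simp add: mult.assoc mult.left_commute)
  show "1 *\<^sub>R a = a" by transfer simp
qed

end

lemma linear_form_of_linear:
  fixes l :: "'g::topological_ab_group_add one_param \<Rightarrow> real"
  assumes "linear l"
  shows "linear_form (lie_algebra UNIV) (\<lambda>\<xi>. l (Abs_one_param \<xi>))"
  unfolding linear_form_def
proof (intro conjI ballI allI)
  fix \<xi> \<eta> :: "real \<Rightarrow> 'g" and c :: real
  assume \<xi>: "\<xi> \<in> lie_algebra UNIV" and \<eta>: "\<eta> \<in> lie_algebra UNIV"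
  show "l (Abs_one_param (\<lambda>s. \<xi> s + \<eta> s)) = l (Abs_one_param \<xi>) + l (Abs_one_param \<eta>)"
    using \<xi> \<eta> linear_add[OF assms, of "Abs_one_param \<xi>" "Abs_one_param \<eta>"]
    by (simp add: plus_one_param.abs_eq eq_onp_def)
next
  fix \<xi> :: "real \<Rightarrow> 'g" and c :: real
  assume \<xi>: "\<xi> \<in> lie_algebra UNIV"
  show "l (Abs_one_param (\<lambda>s. \<xi> (c * s))) = c * l (Abs_one_param \<xi>)"
    using \<xi> linear_scale[OF assms, of c "Abs_one_param \<xi>"]
    by (simp add: scaleR_one_param.abs_eq eq_onp_def)
qed

text \<open>Extend a basis of \<open>V\<close> by \<open>w\<close> and prescribe the values \<open>0\<close> on the basis and \<open>1\<close> at \<open>w\<close>.\<close>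

lemma linear_separating_subspace:
  fixes V :: "'a::real_vector set"
  assumes "subspace V" "w \<notin> V"
  obtains l :: "'a \<Rightarrow> real" where "linear l" "\<And>v. v \<in> V \<Longrightarrow> l v = 0" "l w = 1"
proof -
  obtain B where B: "B \<subseteq> V" "independent B" "V \<subseteq> span B"
    using maximal_independent_subset[of V] by blast
  have "span B \<subseteq> V"
    using B(1) assms(1) by (simp add: span_minimal)
  then have w: "w \<notin> span B"
    using assms(2) by blast
  then obtain l :: "'a \<Rightarrow> real"
    where l: "linear l" "\<forall>x\<in>insert w B. l x = (if x = w then 1 else 0)"
    using linear_independent_extend[OF independent_insertI[OF w B(2)], of "\<lambda>x. if x = w then 1 else 0"]
    by blast
  have "l v = 0" if "v \<in> V" for v
  proof (rule linear_eq_0_on_span[OF l(1)])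
    show "v \<in> span B" using that B(3) by blast
    show "l x = 0" if "x \<in> B" for x
      using that l(2) w span_base by auto
  qed
  with l show thesis using that[of l] by simp
qed

text \<open>A real vector space is not covered by finitely many hyperplanes. If \<open>v\<close> avoids the kernels of the
  forms in \<open>L\<close> and \<open>w\<close> avoids that of one further form, then all but finitely many points of the
  affine line \<open>v + c w\<close> avoid all the kernels.\<close>

lemma linear_forms_common_nonzero:
  fixes L :: "('a::real_vector \<Rightarrow> real) set"
  assumes "finite L" "\<And>l. l \<in> L \<Longrightarrow> linear l" "\<And>l. l \<in> L \<Longrightarrow> \<exists>v. l v \<noteq> 0"
  shows "\<exists>v. \<forall>l\<in>L. l v \<noteq> 0"
  using assms
proof (induction L rule: finite_induct)
  case (insert k L)
  obtain v where v: "\<forall>l\<in>L. l v \<noteq> 0"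
    using insert by auto
  obtain w where w: "k w \<noteq> 0"
    using insert.prems by auto
  \<comment> \<open>The parameters at which the line meets a hyperplane transversally. Forms with \<open>l w = 0\<close> are
    constant along the line and contribute only the harmless value \<open>0\<close>.\<close>
  define bad where "bad = (\<lambda>l. - l v / l w) ` insert k L"
  obtain c where c: "c \<notin> bad"
    using ex_new_if_finite[OF infinite_UNIV_char_0, of bad] insert.hyps unfolding bad_def by auto
  have "l (v + c *\<^sub>R w) \<noteq> 0" if l: "l \<in> insert k L" for l
  proof -
    have eq: "l (v + c *\<^sub>R w) = l v + c * l w"
      using insert.prems(1)[OF l] by (simp add: linear_add linear_scale)
    show ?thesis
    proof (cases "l w = 0")
      case True
      then show ?thesis using eq v w l by auto
    next
      case False
      have "c \<noteq> - l v / l w" using c l unfolding bad_def by blast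
      then show ?thesis using eq False by (auto simp: field_simps)
    qed
  qed
  then show ?case by blast
qed auto


section \<open>Polynomials\<close>

lemma linear_form_subset: "linear_form \<kk> l \<Longrightarrow> \<hh> \<subseteq> \<kk> \<Longrightarrow> linear_form \<hh> l"
  unfolding linear_form_def by blast

lemma polynomials_restrict:
  assumes "f \<in> polynomials \<kk>" "\<hh> \<subseteq> \<kk>"
  shows "restrict f \<hh> \<in> polynomials \<hh>"
  using assms(1)
proof induction
  case (const c)
  have "restrict (\<lambda>\<xi>\<in>\<kk>. c) \<hh> = (\<lambda>\<xi>\<in>\<hh>. c)"
    using assms(2) by (auto simp: fun_eq_iff)
  then show ?case using polynomials.const by metis
next
  case (linear l)
  have "restrict (\<lambda>\<xi>\<in>\<kk>. l \<xi>) \<hh> = (\<lambda>\<xi>\<in>\<hh>. l \<xi>)"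
    using assms(2) by (auto simp: fun_eq_iff)
  then show ?case
    using linear assms(2) linear_form_subset polynomials.linear by metis
next
  case (add f g)
  have "restrict (\<lambda>\<xi>\<in>\<kk>. f \<xi> + g \<xi>) \<hh> = (\<lambda>\<xi>\<in>\<hh>. restrict f \<hh> \<xi> + restrict g \<hh> \<xi>)"
    using assms(2) by (auto simp: fun_eq_iff)
  then show ?case using polynomials.add[OF add.IH] by metis
next
  case (mult f g)
  have "restrict (\<lambda>\<xi>\<in>\<kk>. f \<xi> * g \<xi>) \<hh> = (\<lambda>\<xi>\<in>\<hh>. restrict f \<hh> \<xi> * restrict g \<hh> \<xi>)"
    using assms(2) by (auto simp: fun_eq_iff)
  then show ?case using polynomials.mult[OF mult.IH] by metis
qed

lemma polynomials_extensional: "f \<in> polynomials \<hh> \<Longrightarrow> f \<in> extensional \<hh>"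
  by (erule polynomials.cases) (simp_all only: restrict_extensional)

lemma polynomials_smult:
  assumes "f \<in> polynomials \<kk>" "\<hh> \<subseteq> \<kk>" "g \<in> polynomials \<hh>"
  shows "(\<lambda>\<xi>\<in>\<hh>. f \<xi> * g \<xi>) \<in> polynomials \<hh>"
proof -
  have "(\<lambda>\<xi>\<in>\<hh>. f \<xi> * g \<xi>) = (\<lambda>\<xi>\<in>\<hh>. restrict f \<hh> \<xi> * g \<xi>)"
    by (auto simp: fun_eq_iff)
  then show ?thesis
    using polynomials.mult[OF polynomials_restrict[OF assms(1,2)] assms(3)] by metis
qed

lemma polynomials_prod_linear:
  assumes "finite I" "\<And>i. i \<in> I \<Longrightarrow> linear_form \<hh> (l i)"
  shows "(\<lambda>\<xi>\<in>\<hh>. \<Prod>i\<in>I. l i \<xi>) \<in> polynomials \<hh>"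
  using assms
proof (induction I rule: finite_induct)
  case empty
  then show ?case using polynomials.const[of 1 \<hh>] by (simp only: prod.empty)
next
  case (insert i I)
  have "(\<lambda>\<xi>\<in>\<hh>. \<Prod>j\<in>insert i I. l j \<xi>)
      = (\<lambda>\<xi>\<in>\<hh>. (\<lambda>\<xi>\<in>\<hh>. l i \<xi>) \<xi> * (\<lambda>\<xi>\<in>\<hh>. \<Prod>j\<in>I. l j \<xi>) \<xi>)"
    using insert.hyps by (auto simp: fun_eq_iff)
  moreover have "(\<lambda>\<xi>\<in>\<hh>. l i \<xi>) \<in> polynomials \<hh>"
    using insert.prems by (intro polynomials.linear) simp
  moreover have "(\<lambda>\<xi>\<in>\<hh>. \<Prod>j\<in>I. l j \<xi>) \<in> polynomials \<hh>"
    using insert.prems by (intro insert.IH) simp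
  ultimately show ?case
    using polynomials.mult by metis
qed

text \<open>The polynomial is a product of linear forms, one for each subspace, so it vanishes on every
  subspace and is nonzero wherever none of the forms vanishes. The subspaces are given as sets of
  functions, hence the explicit closure conditions.\<close>

lemma polynomial_vanishing_on_proper_subspaces:
  fixes P :: "(real \<Rightarrow> 'g::topological_ab_group_add) set set"
  assumes "finite P"
    and proper: "\<And>\<hh>. \<hh> \<in> P \<Longrightarrow> \<hh> \<subset> lie_algebra UNIV"
    and zero: "\<And>\<hh>. \<hh> \<in> P \<Longrightarrow> (\<lambda>s. 0) \<in> \<hh>"
    and add: "\<And>\<hh> \<xi> \<eta>. \<hh> \<in> P \<Longrightarrow> \<xi> \<in> \<hh> \<Longrightarrow> \<eta> \<in> \<hh> \<Longrightarrow> (\<lambda>s. \<xi> s + \<eta> s) \<in> \<hh>"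
    and scale: "\<And>\<hh> \<xi> c. \<hh> \<in> P \<Longrightarrow> \<xi> \<in> \<hh> \<Longrightarrow> (\<lambda>s. \<xi> (c * s)) \<in> \<hh>"
  obtains f where "f \<in> polynomials (lie_algebra UNIV)" "\<exists>\<xi>\<in>lie_algebra UNIV. f \<xi> \<noteq> 0"
    "\<And>\<hh> \<xi>. \<hh> \<in> P \<Longrightarrow> \<xi> \<in> \<hh> \<Longrightarrow> f \<xi> = 0"
proof -
  have ex: "\<exists>l :: 'g one_param \<Rightarrow> real. linear l \<and> (\<forall>\<xi>\<in>\<hh>. l (Abs_one_param \<xi>) = 0) \<and> (\<exists>v. l v \<noteq> 0)"
    if \<hh>: "\<hh> \<in> P" for \<hh>
  proof -
    obtain \<xi> where \<xi>: "\<xi> \<in> lie_algebra UNIV" "\<xi> \<notin> \<hh>"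
      using proper[OF \<hh>] by blast
    define V where "V = {v. Rep_one_param v \<in> \<hh>}"
    have "subspace V"
      unfolding subspace_def V_def
      by (simp add: zero_one_param.rep_eq plus_one_param.rep_eq scaleR_one_param.rep_eq
          zero[OF \<hh>] add[OF \<hh>] scale[OF \<hh>])
    moreover have "Abs_one_param \<xi> \<notin> V"
      using \<xi> by (simp add: V_def Abs_one_param_inverse)
    ultimately obtain l :: "'g one_param \<Rightarrow> real"
      where l: "linear l" "\<And>v. v \<in> V \<Longrightarrow> l v = 0" "l (Abs_one_param \<xi>) = 1"
      by (rule linear_separating_subspace) blast
    have "l (Abs_one_param \<eta>) = 0" if "\<eta> \<in> \<hh>" for \<eta>
      using that proper[OF \<hh>] by (intro l(2)) (auto simp: V_def Abs_one_param_inverse)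
    with l show ?thesis by (intro exI[of _ l] conjI exI[of _ "Abs_one_param \<xi>"]) auto
  qed
  then obtain l :: "_ \<Rightarrow> 'g one_param \<Rightarrow> real" where
    l: "\<And>\<hh>. \<hh> \<in> P \<Longrightarrow> linear (l \<hh>)" "\<And>\<hh> \<xi>. \<hh> \<in> P \<Longrightarrow> \<xi> \<in> \<hh> \<Longrightarrow> l \<hh> (Abs_one_param \<xi>) = 0"
      "\<And>\<hh>. \<hh> \<in> P \<Longrightarrow> \<exists>v. l \<hh> v \<noteq> 0"
    by metis
  define f where "f = (\<lambda>\<xi>\<in>lie_algebra UNIV. \<Prod>\<hh>\<in>P. l \<hh> (Abs_one_param \<xi>))"
  show thesis
  proof
    show "f \<in> polynomials (lie_algebra UNIV)"
      unfolding f_def using l(1) assms(1)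
      by (intro polynomials_prod_linear linear_form_of_linear) auto
    have "\<exists>v. \<forall>k\<in>l ` P. k v \<noteq> 0"
      using assms(1) l(1,3) by (intro linear_forms_common_nonzero) auto
    then obtain v where "\<And>\<hh>. \<hh> \<in> P \<Longrightarrow> l \<hh> v \<noteq> 0"
      by auto
    then have "f (Rep_one_param v) \<noteq> 0"
      using assms(1) Rep_one_param[of v] by (simp add: f_def Rep_one_param_inverse)
    then show "\<exists>\<xi>\<in>lie_algebra UNIV. f \<xi> \<noteq> 0"
      using Rep_one_param by blast
    show "f \<xi> = 0" if "\<hh> \<in> P" "\<xi> \<in> \<hh>" for \<hh> \<xi>
      using that l(2)[OF that] assms(1) proper[OF that(1)] by (auto simp: f_def)
  qed
qed


section \<open>Isotropy and fixed points\<close>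

text \<open>The exponential map of a torus is surjective. In coordinates \<open>g\<close> is the tuple of the
  \<open>cis (\<theta> i)\<close>, and \<open>s \<mapsto> (cis (s * \<theta> i))\<^sub>i\<close> is a one-parameter subgroup through it.\<close>

lemma torus_point_on_one_parameter_subgroup:
  fixes g :: "'g::topological_ab_group_add"
  assumes "is_torus (UNIV :: 'g set)"
  obtains \<xi> where "\<xi> \<in> lie_algebra (UNIV :: 'g set)" "\<xi> 1 = g"
proof -
  define S where "S = top_of_set (sphere (0::complex) 1)"
  obtain n :: nat and \<phi> :: "'g \<Rightarrow> nat \<Rightarrow> complex" where
    hom: "homeomorphic_map euclidean (product_topology (\<lambda>_. S) {..<n}) \<phi>"
    and mult: "\<And>g h i. i < n \<Longrightarrow> \<phi> (g + h) i = \<phi> g i * \<phi> h i"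
    using assms unfolding is_torus_def S_def by auto
  obtain \<psi> where maps: "homeomorphic_maps euclidean (product_topology (\<lambda>_. S) {..<n}) \<phi> \<psi>"
    using hom homeomorphic_map_maps by blast
  have cont: "continuous_map (product_topology (\<lambda>_. S) {..<n}) euclidean \<psi>"
    and \<psi>\<phi>: "\<And>x. \<psi> (\<phi> x) = x"
    and \<phi>\<psi>: "\<And>y. y \<in> topspace (product_topology (\<lambda>_. S) {..<n}) \<Longrightarrow> \<phi> (\<psi> y) = y"
    and \<phi>_in: "\<And>x. \<phi> x \<in> topspace (product_topology (\<lambda>_. S) {..<n})"
    using maps unfolding homeomorphic_maps_def continuous_map_def by (auto simp: Pi_iff)
  have top: "topspace (product_topology (\<lambda>_. S) {..<n}) = (\<Pi>\<^sub>E i\<in>{..<n}. sphere 0 1)"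
    by (simp add: S_def)
  have "\<exists>\<theta>. \<phi> g i = cis \<theta>" if "i < n" for i
  proof -
    have "norm (\<phi> g i) = 1" using \<phi>_in[of g] that unfolding top by (auto simp: PiE_iff)
    then show ?thesis using rcis_cmod_Arg[of "\<phi> g i"] by (metis rcis_def of_real_1 mult_1)
  qed
  then obtain \<theta> where \<theta>: "\<And>i. i < n \<Longrightarrow> \<phi> g i = cis (\<theta> i)"
    by metis
  define \<gamma> where "\<gamma> = (\<lambda>s. \<lambda>i\<in>{..<n}. cis (s * \<theta> i))"
  have \<gamma>_in: "\<gamma> s \<in> topspace (product_topology (\<lambda>_. S) {..<n})" for s
    unfolding top \<gamma>_def by auto
  have \<gamma>_cont: "continuous_map euclidean (product_topology (\<lambda>_. S) {..<n}) \<gamma>"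
    unfolding continuous_map_componentwise S_def
    by (auto simp: \<gamma>_def continuous_map_in_subtopology intro!: continuous_intros)
  show thesis
  proof
    have "continuous_on UNIV (\<psi> \<circ> \<gamma>)"
      using continuous_map_compose[OF \<gamma>_cont cont] by simp
    moreover have "(\<psi> \<circ> \<gamma>) (s + t) = (\<psi> \<circ> \<gamma>) s + (\<psi> \<circ> \<gamma>) t" for s t
    proof -
      have "\<phi> (\<psi> (\<gamma> s) + \<psi> (\<gamma> t)) = \<gamma> (s + t)"
      proof (rule PiE_ext)
        show "\<phi> (\<psi> (\<gamma> s) + \<psi> (\<gamma> t)) \<in> (\<Pi>\<^sub>E i\<in>{..<n}. sphere 0 1)" using \<phi>_in unfolding top .
        show "\<gamma> (s + t) \<in> (\<Pi>\<^sub>E i\<in>{..<n}. sphere 0 1)" using \<gamma>_in unfolding top .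
        fix i assume "i \<in> {..<n}"
        then show "\<phi> (\<psi> (\<gamma> s) + \<psi> (\<gamma> t)) i = \<gamma> (s + t) i"
          using \<phi>\<psi>[OF \<gamma>_in] by (simp add: mult) (simp add: \<gamma>_def cis_mult distrib_right)
      qed
      then show ?thesis using \<psi>\<phi> by (metis comp_apply)
    qed
    ultimately show "\<psi> \<circ> \<gamma> \<in> lie_algebra UNIV"
      unfolding lie_algebra_def Modules.additive_def by blast
    have "\<gamma> 1 = \<phi> g"
    proof (rule PiE_ext)
      show "\<gamma> 1 \<in> (\<Pi>\<^sub>E i\<in>{..<n}. sphere 0 1)" using \<gamma>_in unfolding top .
      show "\<phi> g \<in> (\<Pi>\<^sub>E i\<in>{..<n}. sphere 0 1)" using \<phi>_in unfolding top .
    qed (simp add: \<gamma>_def \<theta>)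
    then show "(\<psi> \<circ> \<gamma>) 1 = g" by (simp add: \<psi>\<phi>)
  qed
qed

lemma inf_isotropy_subset: "inf_isotropy act p \<subseteq> lie_algebra UNIV"
  unfolding inf_isotropy_def by (rule lie_algebra_mono) simp

text \<open>If every one-parameter subgroup of the torus fixes \<open>p\<close>, then so does every element, since the
  one-parameter subgroups exhaust the torus.\<close>

lemma inf_isotropy_eq_lie_algebra_iff:
  fixes act :: "'g::topological_ab_group_add \<Rightarrow> 'x \<Rightarrow> 'x"
  assumes "is_torus (UNIV :: 'g set)" "p \<in> topspace X"
  shows "inf_isotropy act p = lie_algebra UNIV \<longleftrightarrow> p \<in> fixed_points act X UNIV"
proof
  assume eq: "inf_isotropy act p = lie_algebra UNIV"
  have "act g p = p" for g
  proof -
    obtain \<xi> where "\<xi> \<in> lie_algebra (UNIV :: 'g set)" "\<xi> 1 = g"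
      using torus_point_on_one_parameter_subgroup[OF assms(1)] .
    then show ?thesis
      using eq unfolding inf_isotropy_def lie_algebra_def isotropy_def by auto
  qed
  then show "p \<in> fixed_points act X UNIV"
    using assms(2) by (simp add: fixed_points_def)
next
  assume "p \<in> fixed_points act X UNIV"
  then have "isotropy act p = UNIV"
    by (auto simp: fixed_points_def isotropy_def)
  then show "inf_isotropy act p = lie_algebra UNIV"
    by (simp add: inf_isotropy_def)
qed

lemma lie_algebra_subset_inf_isotropy:
  "p \<in> fixed_points act X H \<Longrightarrow> lie_algebra H \<subseteq> inf_isotropy act p"
  unfolding inf_isotropy_def by (rule lie_algebra_mono) (auto simp: fixed_points_def isotropy_def)

lemma inf_isotropy_subspace:
  assumes "continuous_action act X" "p \<in> topspace X"
  shows "(\<lambda>s. 0) \<in> inf_isotropy act p"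
    and "\<xi> \<in> inf_isotropy act p \<Longrightarrow> \<eta> \<in> inf_isotropy act p \<Longrightarrow> (\<lambda>s. \<xi> s + \<eta> s) \<in> inf_isotropy act p"
    and "\<xi> \<in> inf_isotropy act p \<Longrightarrow> (\<lambda>s. \<xi> (c * s)) \<in> inf_isotropy act p"
proof -
  have "0 \<in> isotropy act p"
    and add: "\<And>g h. g \<in> isotropy act p \<Longrightarrow> h \<in> isotropy act p \<Longrightarrow> g + h \<in> isotropy act p"
    using assms by (auto simp: isotropy_def continuous_action_def)
  then show "(\<lambda>s. 0) \<in> inf_isotropy act p"
    unfolding inf_isotropy_def by (intro lie_algebra_zero)
  show "(\<lambda>s. \<xi> s + \<eta> s) \<in> inf_isotropy act p"
    if "\<xi> \<in> inf_isotropy act p" "\<eta> \<in> inf_isotropy act p"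
    using lie_algebra_add[OF add] that unfolding inf_isotropy_def by blast
  show "(\<lambda>s. \<xi> (c * s)) \<in> inf_isotropy act p" if "\<xi> \<in> inf_isotropy act p"
    using lie_algebra_scale that unfolding inf_isotropy_def by blast
qed


section \<open>Assignments\<close>

lemma locally_constant_on_const:
  assumes "S \<subseteq> topspace X" "\<And>p. p \<in> S \<Longrightarrow> f p = c"
  shows "locally_constant_on X S f"
proof -
  have "openin (subtopology X S) S"
    using openin_topspace[of "subtopology X S"] assms(1) by (simp add: Int_absorb1)
  then show ?thesis
    using assms(2) unfolding locally_constant_on_def by metis
qed

text \<open>Local constancy passes to every function whose value is determined by the values of two locally
  constant functions.\<close>

lemma locally_constant_on_combine:
  assumes "locally_constant_on X S a" "locally_constant_on X S b"
    and "\<And>p q. p \<in> S \<Longrightarrow> q \<in> S \<Longrightarrow> a p = a q \<Longrightarrow> b p = b q \<Longrightarrow> c p = c q"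
  shows "locally_constant_on X S c"
  unfolding locally_constant_on_def
proof
  fix p assume p: "p \<in> S"
  obtain U where U: "openin (subtopology X S) U" "p \<in> U" "\<forall>q\<in>U. a q = a p"
    using assms(1) p unfolding locally_constant_on_def by blast
  obtain V where V: "openin (subtopology X S) V" "p \<in> V" "\<forall>q\<in>V. b q = b p"
    using assms(2) p unfolding locally_constant_on_def by blast
  have "U \<subseteq> S" using openin_subset[OF U(1)] by auto
  then have "\<forall>q\<in>U \<inter> V. c q = c p" using U V p assms(3) by blast
  moreover have "openin (subtopology X S) (U \<inter> V)" "p \<in> U \<inter> V"
    using U V openin_Int by blast+
  ultimately show "\<exists>U. openin (subtopology X S) U \<and> p \<in> U \<and> (\<forall>q\<in>U. c q = c p)"
    by blast
qed

lemma assignments_linear_combination: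
  assumes A: "A \<in> assignments act X" and B: "B \<in> assignments act X"
  shows "(\<lambda>p\<in>topspace X. \<lambda>\<xi>\<in>inf_isotropy act p. A p \<xi> + c * B p \<xi>) \<in> assignments act X"
    (is "?C \<in> _")
proof -
  have "?C p \<in> polynomials (inf_isotropy act p)" if p: "p \<in> topspace X" for p
  proof -
    have "A p \<in> polynomials (inf_isotropy act p)" "B p \<in> polynomials (inf_isotropy act p)"
      using A B p unfolding assignments_def by (auto simp: PiE_iff)
    moreover from this have "(\<lambda>\<xi>\<in>inf_isotropy act p. (\<lambda>\<xi>\<in>inf_isotropy act p. c) \<xi> * B p \<xi>)
        \<in> polynomials (inf_isotropy act p)"
      by (intro polynomials.mult polynomials.const)
    ultimately have "(\<lambda>\<xi>\<in>inf_isotropy act p. A p \<xi> +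
        (\<lambda>\<xi>\<in>inf_isotropy act p. (\<lambda>\<xi>\<in>inf_isotropy act p. c) \<xi> * B p \<xi>) \<xi>)
        \<in> polynomials (inf_isotropy act p)"
      by (intro polynomials.add)
    then show ?thesis using p by (simp cong: restrict_cong)
  qed
  moreover have "locally_constant_on X (fixed_points act X H) (\<lambda>p. restrict (?C p) (lie_algebra H))"
    if H: "is_torus H" for H
  proof (rule locally_constant_on_combine)
    show "locally_constant_on X (fixed_points act X H) (\<lambda>p. restrict (A p) (lie_algebra H))"
      and "locally_constant_on X (fixed_points act X H) (\<lambda>p. restrict (B p) (lie_algebra H))"
      using A B H unfolding assignments_def by auto
    fix p q
    assume p: "p \<in> fixed_points act X H" and q: "q \<in> fixed_points act X H"
      and eqA: "restrict (A p) (lie_algebra H) = restrict (A q) (lie_algebra H)"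
      and eqB: "restrict (B p) (lie_algebra H) = restrict (B q) (lie_algebra H)"
    show "restrict (?C p) (lie_algebra H) = restrict (?C q) (lie_algebra H)"
    proof (rule restrict_ext)
      fix \<xi> assume \<xi>: "\<xi> \<in> lie_algebra H"
      have "A p \<xi> = A q \<xi>" "B p \<xi> = B q \<xi>"
        using fun_cong[OF eqA, of \<xi>] fun_cong[OF eqB, of \<xi>] \<xi> by auto
      moreover have "p \<in> topspace X" "q \<in> topspace X" using p q by (auto simp: fixed_points_def)
      ultimately show "?C p \<xi> = ?C q \<xi>"
        using \<xi> lie_algebra_subset_inf_isotropy[OF p] lie_algebra_subset_inf_isotropy[OF q] by auto
    qed
  qed
  ultimately show ?thesis unfolding assignments_def by auto
qed

lemma restrict_assignment:
  assumes A: "A \<in> assignments act X" and Y: "Y \<subseteq> topspace X"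
  shows "restrict A Y \<in> assignments act (subtopology X Y)"
proof -
  have "locally_constant_on (subtopology X Y) (fixed_points act (subtopology X Y) H)
      (\<lambda>p. restrict (restrict A Y p) (lie_algebra H))" if H: "is_torus H" for H
    unfolding locally_constant_on_def
  proof
    fix p assume "p \<in> fixed_points act (subtopology X Y) H"
    moreover have fix_eq: "fixed_points act (subtopology X Y) H = Y \<inter> fixed_points act X H"
      by (auto simp: fixed_points_def)
    ultimately have p: "p \<in> Y" "p \<in> fixed_points act X H" by auto
    then obtain U where U: "openin (subtopology X (fixed_points act X H)) U" "p \<in> U"
      "\<forall>q\<in>U. restrict (A q) (lie_algebra H) = restrict (A p) (lie_algebra H)"
      using A H unfolding assignments_def locally_constant_on_def by blast
    have "openin (subtopology (subtopology X Y) (fixed_points act (subtopology X Y) H)) (Y \<inter> U)"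
    proof -
      obtain W where W: "openin X W" "U = W \<inter> fixed_points act X H"
        using U(1) unfolding openin_subtopology by blast
      have "openin (subtopology X Y) (W \<inter> Y)"
        unfolding openin_subtopology using W(1) by blast
      moreover have "Y \<inter> U = (W \<inter> Y) \<inter> fixed_points act (subtopology X Y) H"
        unfolding W(2) fix_eq by blast
      ultimately show ?thesis
        unfolding openin_subtopology[of "subtopology X Y"] by blast
    qed
    moreover have "restrict (restrict A Y q) (lie_algebra H) = restrict (restrict A Y p) (lie_algebra H)"
      if "q \<in> Y \<inter> U" for q
      using U(3) p(1) that by (metis IntE restrict_apply)
    moreover have "p \<in> Y \<inter> U"
      using p(1) U(2) by blast
    ultimately show "\<exists>V. openin (subtopology (subtopology X Y) (fixed_points act (subtopology X Y) H)) V
        \<and> p \<in> V \<and> (\<forall>q\<in>V. restrict (restrict A Y q) (lie_algebra H)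
                        = restrict (restrict A Y p) (lie_algebra H))"
      by blast
  qed
  then show ?thesis
    using A Y unfolding assignments_def by (auto simp: PiE_iff Int_absorb1)
qed

text \<open>The hypothesis on \<open>f\<close> makes the jump from \<open>f A\<close> to zero at the boundary of \<open>X\<^sup>T\<close> invisible: a
  set \<open>X\<^sup>H\<close> that contains points outside \<open>X\<^sup>T\<close> forces \<open>f\<close> to vanish on the Lie algebra of \<open>H\<close>,
  where the values are compared.\<close>

lemma assignments_smult_extension_by_zero:
  fixes act :: "'g::topological_ab_group_add \<Rightarrow> 'x \<Rightarrow> 'x" and X :: "'x topology"
  defines "F \<equiv> fixed_points act X UNIV"
  assumes A: "A \<in> assignments act (subtopology X F)"
    and f: "f \<in> polynomials (lie_algebra UNIV)"
    and van: "\<And>p \<xi>. p \<in> topspace X \<Longrightarrow> p \<notin> F \<Longrightarrow> \<xi> \<in> inf_isotropy act p \<Longrightarrow> f \<xi> = 0"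
  shows "(\<lambda>p\<in>topspace X. \<lambda>\<xi>\<in>inf_isotropy act p. if p \<in> F then f \<xi> * A p \<xi> else 0)
           \<in> assignments act X"
    (is "?B \<in> _")
proof -
  have F_sub: "F \<subseteq> topspace X" by (auto simp: F_def fixed_points_def)
  then have top: "topspace (subtopology X F) = F" by auto
  have "?B p \<in> polynomials (inf_isotropy act p)" if p: "p \<in> topspace X" for p
  proof (cases "p \<in> F")
    case True
    then have "A p \<in> polynomials (inf_isotropy act p)"
      using A top unfolding assignments_def by (auto simp: PiE_iff)
    then show ?thesis using polynomials_smult[OF f inf_isotropy_subset] p True by simp
  next
    case False
    then show ?thesis using p by (simp add: polynomials.const)
  qed
  moreover have "locally_constant_on X (fixed_points act X H) (\<lambda>p. restrict (?B p) (lie_algebra H))"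
    if H: "is_torus H" for H
  proof (cases "fixed_points act X H \<subseteq> F")
    case True
    then have eq: "fixed_points act X H = F"
      by (auto simp: F_def fixed_points_def)
    then have "fixed_points act (subtopology X F) H = F"
      by (auto simp: fixed_points_def)
    then have lc: "locally_constant_on X (F) (\<lambda>p. restrict (A p) (lie_algebra H))"
      using A H unfolding assignments_def locally_constant_on_def
      by (auto simp: subtopology_subtopology)
    show ?thesis
      unfolding eq
    proof (rule locally_constant_on_combine[OF lc lc])
      fix p q
      assume p: "p \<in> F" and q: "q \<in> F"
        and eqA: "restrict (A p) (lie_algebra H) = restrict (A q) (lie_algebra H)"
      show "restrict (?B p) (lie_algebra H) = restrict (?B q) (lie_algebra H)"
      proof (rule restrict_ext)
        fix \<xi> assume \<xi>: "\<xi> \<in> lie_algebra H"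
        have "A p \<xi> = A q \<xi>"
          using fun_cong[OF eqA, of \<xi>] \<xi> by auto
        moreover have "\<xi> \<in> inf_isotropy act p" "\<xi> \<in> inf_isotropy act q"
          using \<xi> p q eq lie_algebra_subset_inf_isotropy[of _ act X H] by (simp_all add: subset_iff)
        ultimately show "?B p \<xi> = ?B q \<xi>"
          using p q F_sub by (simp add: subset_iff)
      qed
    qed
  next
    case False
    then obtain q where q: "q \<in> fixed_points act X H" "q \<notin> F" by blast
    have f0: "f \<xi> = 0" if "\<xi> \<in> lie_algebra H" for \<xi>
      using van[OF _ q(2)] that lie_algebra_subset_inf_isotropy[OF q(1)] q(1)
      by (auto simp: fixed_points_def)
    show ?thesis
    proof (rule locally_constant_on_const)
      show "fixed_points act X H \<subseteq> topspace X" by (auto simp: fixed_points_def)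
      fix p assume p: "p \<in> fixed_points act X H"
      show "restrict (?B p) (lie_algebra H) = (\<lambda>\<xi>\<in>lie_algebra H. 0)"
      proof (rule restrict_ext)
        fix \<xi> assume \<xi>: "\<xi> \<in> lie_algebra H"
        have "p \<in> topspace X" using p by (simp add: fixed_points_def)
        moreover have "\<xi> \<in> inf_isotropy act p"
          using lie_algebra_subset_inf_isotropy[OF p] \<xi> by (rule subsetD)
        ultimately show "?B p \<xi> = 0" using f0[OF \<xi>] by simp
      qed
    qed
  qed
  ultimately show ?thesis unfolding assignments_def by auto
qed


section \<open>The cokernel\<close>

text \<open>A scalar that maps all of \<open>M\<close> into \<open>N\<close> kills the quotient: the scalar multiple of a coset is a
  union of cosets \<open>N + r x\<close>, nonempty, each of them equal to \<open>N\<close>. Of the group structure of \<open>N\<close>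
  this uses closure under sums and differences, stated without reference to an inverse operation.\<close>

lemma quotient_module_smult_eq_zero:
  assumes sub: "N \<subseteq> carrier M"
    and add: "\<And>x y. x \<in> carrier M \<Longrightarrow> y \<in> carrier M \<Longrightarrow> x \<oplus>\<^bsub>M\<^esub> y \<in> carrier M"
    and N_add: "\<And>x y. x \<in> N \<Longrightarrow> y \<in> N \<Longrightarrow> x \<oplus>\<^bsub>M\<^esub> y \<in> N"
    and N_diff: "\<And>x y. x \<in> N \<Longrightarrow> y \<in> N \<Longrightarrow> \<exists>z\<in>N. z \<oplus>\<^bsub>M\<^esub> y = x"
    and kill: "\<And>x. x \<in> carrier M \<Longrightarrow> r \<odot>\<^bsub>M\<^esub> x \<in> N"
    and C: "C \<in> carrier (quotient_module M N)"
  shows "r \<odot>\<^bsub>quotient_module M N\<^esub> C = \<zero>\<^bsub>quotient_module M N\<^esub>"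
proof -
  obtain a where a: "a \<in> carrier M" "C = N +>\<^bsub>M\<^esub> a"
    using C by (auto simp: quotient_module_def A_RCOSETS_defs a_r_coset_def)
  have "C \<subseteq> carrier M" "C \<noteq> {}"
    using a sub add kill by (auto simp: a_r_coset_def')
  moreover have "N +>\<^bsub>M\<^esub> y = N" if "y \<in> N" for y
    using that N_add N_diff[of _ y] by (fastforce simp: a_r_coset_def')
  ultimately have "(\<Union>x\<in>C. N +>\<^bsub>M\<^esub> (r \<odot>\<^bsub>M\<^esub> x)) = N"
    using kill by auto
  then show ?thesis by (simp add: quotient_module_def)
qed

theorem proposition4p3:
  fixes act :: "'g::topological_ab_group_add \<Rightarrow> 'x \<Rightarrow> 'x" and X :: "'x topology"
  assumes "is_torus (UNIV :: 'g set)"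
    and "continuous_action act X"
    and "finite (inf_isotropy act ` topspace X)"
  shows "torsion_module (polynomial_ring (lie_algebra (UNIV :: 'g set)))
           (cokernel (assignment_algebra act X)
              (assignment_algebra act (subtopology X (fixed_points act X UNIV)))
              (restriction_map (fixed_points act X UNIV)))"
proof -
  define F where "F = fixed_points act X UNIV"
  define M where "M = assignment_algebra act (subtopology X F)"
  define N where "N = restriction_map F ` assignments act X"
  define P where "P = inf_isotropy act ` topspace X - {lie_algebra UNIV}"
  have F_sub: "F \<subseteq> topspace X" by (auto simp: F_def fixed_points_def)
  then have top: "topspace (subtopology X F) = F" by auto
  note M_simps = M_def assignment_algebra_def top
  obtain f where f: "f \<in> polynomials (lie_algebra UNIV)" "\<exists>\<xi>\<in>lie_algebra UNIV. f \<xi> \<noteq> 0"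
    and f_van: "\<And>\<hh> \<xi>. \<hh> \<in> P \<Longrightarrow> \<xi> \<in> \<hh> \<Longrightarrow> f \<xi> = 0"
  proof (rule polynomial_vanishing_on_proper_subspaces[of P])
    show "finite P" using assms(3) by (simp add: P_def)
    show "\<hh> \<subset> lie_algebra UNIV" if "\<hh> \<in> P" for \<hh>
      using that inf_isotropy_subset by (fastforce simp: P_def)
  qed (auto simp: P_def intro: inf_isotropy_subspace[OF assms(2)])
  have van: "f \<xi> = 0" if "p \<in> topspace X" "p \<notin> F" "\<xi> \<in> inf_isotropy act p" for p \<xi>
    using that inf_isotropy_eq_lie_algebra_iff[OF assms(1) that(1), of act]
    by (intro f_van[of "inf_isotropy act p"]) (auto simp: P_def F_def)
  have kill: "f \<odot>\<^bsub>M\<^esub> A \<in> N" if A: "A \<in> carrier M" for A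
  proof -
    let ?B = "\<lambda>p\<in>topspace X. \<lambda>\<xi>\<in>inf_isotropy act p. if p \<in> F then f \<xi> * A p \<xi> else 0"
    have "?B \<in> assignments act X"
      unfolding F_def
      by (rule assignments_smult_extension_by_zero[OF _ f(1)])
        (use A van in \<open>auto simp: M_simps F_def\<close>)
    moreover have "f \<odot>\<^bsub>M\<^esub> A = restriction_map F ?B"
      using F_sub by (auto simp: M_simps restriction_map_def fun_eq_iff)
    ultimately show ?thesis unfolding N_def by blast
  qed
  have M_add: "A \<oplus>\<^bsub>M\<^esub> B \<in> carrier M" if "A \<in> carrier M" "B \<in> carrier M" for A B
    using assignments_linear_combination[of A act "subtopology X F" B 1] that
    by (simp add: M_simps)
  have N_sub: "N \<subseteq> carrier M"
    unfolding N_def restriction_map_def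
    using restrict_assignment[OF _ F_sub] by (auto simp: M_simps)
  have N_add: "x \<oplus>\<^bsub>M\<^esub> y \<in> N" if xy: "x \<in> N" "y \<in> N" for x y
  proof -
    obtain A B where AB: "A \<in> assignments act X" "B \<in> assignments act X"
      "x = restrict A F" "y = restrict B F"
      using xy unfolding N_def restriction_map_def by blast
    let ?C = "\<lambda>p\<in>topspace X. \<lambda>\<xi>\<in>inf_isotropy act p. A p \<xi> + 1 * B p \<xi>"
    have "x \<oplus>\<^bsub>M\<^esub> y = restriction_map F ?C"
      using F_sub by (auto simp: AB M_simps restriction_map_def fun_eq_iff)
    then show ?thesis
      using assignments_linear_combination[OF AB(1,2)] unfolding N_def by blast
  qed
  have N_diff: "\<exists>z\<in>N. z \<oplus>\<^bsub>M\<^esub> y = x" if xy: "x \<in> N" "y \<in> N" for x y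
  proof -
    obtain A B where AB: "A \<in> assignments act X" "B \<in> assignments act X"
      "x = restrict A F" "y = restrict B F"
      using xy unfolding N_def restriction_map_def by blast
    let ?C = "\<lambda>p\<in>topspace X. \<lambda>\<xi>\<in>inf_isotropy act p. A p \<xi> + (-1) * B p \<xi>"
    have "A p \<in> extensional (inf_isotropy act p)" if "p \<in> F" for p
      using AB(1) that F_sub polynomials_extensional unfolding assignments_def
      by (fastforce simp: PiE_iff)
    then have "restriction_map F ?C \<oplus>\<^bsub>M\<^esub> y = x"
      using F_sub by (auto simp: AB M_simps restriction_map_def fun_eq_iff extensional_def)
    then show ?thesis
      using assignments_linear_combination[OF AB(1,2), of "-1"] unfolding N_def by blast
  qed
  have "f \<odot>\<^bsub>quotient_module M N\<^esub> C = \<zero>\<^bsub>quotient_module M N\<^esub>"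
    if "C \<in> carrier (quotient_module M N)" for C
    using N_sub M_add N_add N_diff kill that by (rule quotient_module_smult_eq_zero)
  moreover have "f \<noteq> \<zero>\<^bsub>polynomial_ring (lie_algebra UNIV)\<^esub>"
    using f(2) by (auto simp: polynomial_ring_def)
  moreover have "cokernel (assignment_algebra act X) M (restriction_map F) = quotient_module M N"
    by (simp add: cokernel_def N_def assignment_algebra_def)
  ultimately show ?thesis
    using f(1) unfolding torsion_module_def M_def[symmetric] F_def[symmetric]
    by (auto simp: polynomial_ring_def)
qed

end
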